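(* Let $\delta\in(0,1)$. In the constrained MDP with stochastic thresholds described in the context, with probability at least $1-\delta$ the following holds simultaneously for every constraint $i\in[m]$, step $h\in[H]$, episode $t\in[T]$ and state-action pair $(s,a)\in\mathcal S\times\mathcal A$: $$\left|\hat\alpha_{i,h}^{(W_t),t}(s,a)-\alpha_{i,h}\right|\le \zeta_h^{(W_t),t}(s,a),\qquad \zeta_h^{(W_t),t}(s,a)=\min\left\{1,\sqrt{\frac{4\ln(mSAHT/\delta)}{\max\{1,N_h^{(W_t),t-1}(s,a)\}}}\right\}.$$
   Context: Setting. $\mathcal S$ and $\mathcal A$ are finite sets with $|\mathcal S|=S$, $|\mathcal A|=A$; $H$ is the horizon, $m$ the number of constraints, $T$ the number of episodes, $[n]=\{1,\dots,n\}$. Before each episode $l\in[T]$ the learner chooses (possibly depending on the data of earlier episodes) a policy $\pi_l=(\pi_{l,1},\dots,\pi_{l,H})$, where $\pi_{l,h}(\cdot\mid s)$ is a probability distribution on $\mathcal A$. The episode starts in a fixed state $s_1^l=s_1$; at step $h$ the agent is in $s_h^l$, draws $a_h^l\sim\pi_{l,h}(\cdot\mid s_h^l)$, and the next state is drawn from $p_h(\cdot\mid s_h^l,a_h^l)$. At each visited pair $(s,a)$ at step $h$ of episode $l$ the agent observes, for each $i\in[m]$, a noisy threshold signal $\tilde\alpha_{i,h}^l(s,a)\in[0,1]$, a fresh draw from an unknown distribution $\mathcal L_{i,h}$ with mean $\alpha_{i,h}\in[0,1]$ (the mean does not depend on $(s,a)$ or on $l$). Growing-Window estimator. $\{W_t\}_{t=1}^T$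 is a (deterministic) nondecreasing sequence of window lengths, e.g. $W_t=\lfloor\gamma t\rfloor$ with a constant $\gamma\in(0,1]$. Put $$N_h^{(W_t),t-1}(s,a)=\sum_{l=\max\{1,t-W_t+1\}}^{t-1}\mathbf 1_{\{s_h^l=s,a_h^l=a\}},\qquad N_h^{(W_t),t}(s,a)=\sum_{l=\max\{1,t-W_t+1\}}^{t}\mathbf 1_{\{s_h^l=s,a_h^l=a\}},$$ $$\hat\alpha_{i,h}^{(W_t),t}(s,a)=\frac{\sum_{l=\max\{1,t-W_t+1\}}^{t}\tilde\alpha_{i,h}^l(s,a)\,\mathbf 1_{\{s_h^l=s,a_h^l=a\}}}{\max\{1,N_h^{(W_t),t}(s,a)\}}.$$
   Formalization: The case m=S=A=H=T=1 is restricted to δ ≤ exp(-1/4); for larger δ the claim as written fails there, e.g. with δ=0.99, W_1=1 and a Bernoulli(1/2) threshold signal. *)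

theory Defs
  imports "HOL-Probability.Probability"
begin

text \<open>
  Episodes \<open>l\<close>, steps \<open>h\<close> and constraints \<open>i\<close> are counted from 1.
  The \<open>\<sigma>\<close>-algebras describe what has been realised in episode \<open>l\<close>, step \<open>h\<close>
  once the state is known (\<open>FS\<close>), once the action has been drawn (\<open>FA\<close>), and once the threshold
  signals have been observed (\<open>FO\<close>). They are only required to contain the states, actions and
  observed signals so far, so they may contain further data (rewards, internal randomisation of the
  learner) on which the policies may depend as well; the \<open>\<sigma>\<close>-algebras generated by the
  interaction are the minimal choice. In particular \<open>FS l 1\<close> is the information available
  when the policy of episode \<open>l\<close> is chosen, as the initial state is fixed.

  The signal \<open>sig i h l s a\<close> is observed only if \<open>(s, a)\<close> is the pair visited at
  step \<open>h\<close> of episode \<open>l\<close>, and only then is its (conditional) distribution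
  prescribed. The joint distribution of the signals of different constraints is left open.
\<close>

locale cmdp_stochastic_thresholds = prob_space M
  for M :: "'w measure" +
  fixes m H T :: nat
    and s1 :: "'s :: finite"
    and p :: "nat \<Rightarrow> 's \<Rightarrow> 'a :: finite \<Rightarrow> 's pmf"
    and \<L> :: "nat \<Rightarrow> nat \<Rightarrow> real measure"
    and \<alpha> :: "nat \<Rightarrow> nat \<Rightarrow> real"
    and \<pi> :: "nat \<Rightarrow> nat \<Rightarrow> 'w \<Rightarrow> 's \<Rightarrow> 'a pmf"
    and st :: "nat \<Rightarrow> nat \<Rightarrow> 'w \<Rightarrow> 's"
    and ac :: "nat \<Rightarrow> nat \<Rightarrow> 'w \<Rightarrow> 'a"
    and sig :: "nat \<Rightarrow> nat \<Rightarrow> nat \<Rightarrow> 's \<Rightarrow> 'a \<Rightarrow> 'w \<Rightarrow> real"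
    and FS FA FO :: "nat \<Rightarrow> nat \<Rightarrow> 'w measure"
  assumes threshold_law:
      "\<And>i h. i \<in> {1..m} \<Longrightarrow> h \<in> {1..H} \<Longrightarrow>
         prob_space (\<L> i h) \<and> sets (\<L> i h) = sets borel \<and> (AE x in \<L> i h. x \<in> {0..1})"
    and threshold_mean:
      "\<And>i h. i \<in> {1..m} \<Longrightarrow> h \<in> {1..H} \<Longrightarrow> \<alpha> i h = (\<integral>x. x \<partial>\<L> i h)"
    and filtration:
      "\<And>l h. l \<in> {1..T} \<Longrightarrow> h \<in> {1..H} \<Longrightarrow>
         subalgebra (FA l h) (FS l h) \<and> subalgebra (FO l h) (FA l h) \<and> subalgebra M (FO l h)"
    and filtration_step:
      "\<And>l h. l \<in> {1..T} \<Longrightarrow> h \<in> {1..<H} \<Longrightarrow> subalgebra (FS l (Suc h)) (FO l h)"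
    and filtration_episode:
      "\<And>l. l \<in> {1..<T} \<Longrightarrow> H \<ge> 1 \<Longrightarrow> subalgebra (FS (Suc l) 1) (FO l H)"
    and state_measurable:
      "\<And>l h. l \<in> {1..T} \<Longrightarrow> h \<in> {1..H} \<Longrightarrow> st l h \<in> measurable (FS l h) (count_space UNIV)"
    and action_measurable:
      "\<And>l h. l \<in> {1..T} \<Longrightarrow> h \<in> {1..H} \<Longrightarrow> ac l h \<in> measurable (FA l h) (count_space UNIV)"
    and signal_measurable:
      "\<And>i h l s a. i \<in> {1..m} \<Longrightarrow> h \<in> {1..H} \<Longrightarrow> l \<in> {1..T} \<Longrightarrow>
         sig i h l s a \<in> borel_measurable M"
    and observed_signal_measurable:
      "\<And>i h l. i \<in> {1..m} \<Longrightarrow> h \<in> {1..H} \<Longrightarrow> l \<in> {1..T} \<Longrightarrow>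
         (\<lambda>\<omega>. sig i h l (st l h \<omega>) (ac l h \<omega>) \<omega>) \<in> borel_measurable (FO l h)"
    and policy_measurable:
      "\<And>l h s a. l \<in> {1..T} \<Longrightarrow> h \<in> {1..H} \<Longrightarrow>
         (\<lambda>\<omega>. pmf (\<pi> l h \<omega> s) a) \<in> borel_measurable (FS l 1)"
    and initial_state:
      "\<And>l \<omega>. l \<in> {1..T} \<Longrightarrow> \<omega> \<in> space M \<Longrightarrow> st l 1 \<omega> = s1"
    and action_law:
      "\<And>l h a. l \<in> {1..T} \<Longrightarrow> h \<in> {1..H} \<Longrightarrow>
         AE \<omega> in M. real_cond_exp M (FS l h) (indicator {\<omega> \<in> space M. ac l h \<omega> = a}) \<omega>
                     = pmf (\<pi> l h \<omega> (st l h \<omega>)) a"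
    and signal_law:
      "\<And>i h l s a B. i \<in> {1..m} \<Longrightarrow> h \<in> {1..H} \<Longrightarrow> l \<in> {1..T} \<Longrightarrow> B \<in> sets borel \<Longrightarrow>
         AE \<omega> in M. st l h \<omega> = s \<and> ac l h \<omega> = a \<longrightarrow>
           real_cond_exp M (FA l h) (indicator {\<omega> \<in> space M. sig i h l s a \<omega> \<in> B}) \<omega>
             = measure (\<L> i h) B"
    and transition_law:
      "\<And>l h s'. l \<in> {1..T} \<Longrightarrow> h \<in> {1..<H} \<Longrightarrow>
         AE \<omega> in M. real_cond_exp M (FO l h) (indicator {\<omega> \<in> space M. st l (Suc h) \<omega> = s'}) \<omega>
                     = pmf (p h (st l h \<omega>) (ac l h \<omega>)) s'"

text \<open>
  First episode of the window, \<open>max {1, t - W\<^sub>t + 1}\<close>. Truncated subtraction is harmless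
  here: if \<open>W t > t\<close>, both readings give 1.
\<close>

definition window_start :: "(nat \<Rightarrow> nat) \<Rightarrow> nat \<Rightarrow> nat" where
  "window_start W t = max 1 (t - W t + 1)"

text \<open>
  Number of visits of \<open>(s, a)\<close> at step \<open>h\<close> from the start of the window of
  episode \<open>t\<close> up to episode \<open>u\<close>; it is used with \<open>u = t - 1\<close> and \<open>u = t\<close>.
\<close>

definition visit_count ::
  "(nat \<Rightarrow> nat) \<Rightarrow> (nat \<Rightarrow> nat \<Rightarrow> 'w \<Rightarrow> 's) \<Rightarrow> (nat \<Rightarrow> nat \<Rightarrow> 'w \<Rightarrow> 'a) \<Rightarrow>
   nat \<Rightarrow> nat \<Rightarrow> nat \<Rightarrow> 's \<Rightarrow> 'a \<Rightarrow> 'w \<Rightarrow> nat" where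
  "visit_count W st ac h t u s a \<omega> =
     (\<Sum>l = window_start W t..u. of_bool (st l h \<omega> = s \<and> ac l h \<omega> = a))"

definition alpha_hat ::
  "(nat \<Rightarrow> nat) \<Rightarrow> (nat \<Rightarrow> nat \<Rightarrow> 'w \<Rightarrow> 's) \<Rightarrow> (nat \<Rightarrow> nat \<Rightarrow> 'w \<Rightarrow> 'a) \<Rightarrow>
   (nat \<Rightarrow> nat \<Rightarrow> nat \<Rightarrow> 's \<Rightarrow> 'a \<Rightarrow> 'w \<Rightarrow> real) \<Rightarrow>
   nat \<Rightarrow> nat \<Rightarrow> nat \<Rightarrow> 's \<Rightarrow> 'a \<Rightarrow> 'w \<Rightarrow> real" where
  "alpha_hat W st ac sig i h t s a \<omega> =
     (\<Sum>l = window_start W t..t. sig i h l s a \<omega> * of_bool (st l h \<omega> = s \<and> ac l h \<omega> = a))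
       / real (max 1 (visit_count W st ac h t t s a \<omega>))"

definition zeta ::
  "nat \<Rightarrow> nat \<Rightarrow> nat \<Rightarrow> real \<Rightarrow>
   (nat \<Rightarrow> nat) \<Rightarrow> (nat \<Rightarrow> nat \<Rightarrow> 'w \<Rightarrow> 's::finite) \<Rightarrow> (nat \<Rightarrow> nat \<Rightarrow> 'w \<Rightarrow> 'a::finite) \<Rightarrow>
   nat \<Rightarrow> nat \<Rightarrow> 's \<Rightarrow> 'a \<Rightarrow> 'w \<Rightarrow> real" where
  "zeta m H T \<delta> W st ac h t s a \<omega> =
     min 1 (sqrt (4 * ln (real (m * CARD('s) * CARD('a) * H * T) / \<delta>)
                    / real (max 1 (visit_count W st ac h t (t - 1) s a \<omega>))))"

end

theory Submission imports Defs begin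

text \<open>
  Fix a constraint, a step, a pair and an episode \<open>t\<close>, and let \<open>D\<close> be the sum of
  the deviations \<open>signal - \<alpha>\<close> over the \<open>N\<close> visits in the window. By Hoeffding's lemma,
  applied conditionally on each visit, \<open>exp (\<theta> D - \<theta>\<^sup>2 N / 8)\<close> has expectation at most 1.
  Markov's inequality on \<open>{N = n}\<close> bounds the probability of \<open>\<bar>D\<bar> \<ge> \<epsilon> n\<close> there by
  \<open>2 exp (- 2 \<epsilon>\<^sup>2 n)\<close>; with \<open>\<epsilon>\<^sup>2 = 4 ln (K / \<delta>) / n\<close> and
  \<open>K = m S A H T\<close> this is \<open>2 (\<delta> / K)\<^sup>8\<close>, so there is ample room for the union
  bound over the indices and \<open>n \<le> T\<close>. Replacing the count up to \<open>t\<close> by the count up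
  to \<open>t - 1\<close> only enlarges the radius, and for \<open>N = 0\<close> the radius is 1, because
  \<open>4 ln (K / \<delta>) \<ge> 1\<close>.
\<close>

section \<open>Conditional laws, Hoeffding's lemma and products of conditionally bounded
  factors\<close>

text \<open>Under the density \<open>f\<close>, the variable \<open>X\<close> has law
  \<open>L\<close> up to the total mass: for each Borel set, conditioning on \<open>F\<close>
  replaces the indicator of \<open>X \<in> B\<close> by \<open>measure L B\<close> wherever
  \<open>f\<close> is nonzero. Equality of measures then carries this over to every
  \<open>g\<close>. With values in \<open>ennreal\<close>, no integrability has to be
  checked.\<close>

lemma (in sigma_finite_subalgebra) nn_integral_mult_cond_law:
  fixes f :: "'a \<Rightarrow> ennreal" and g :: "real \<Rightarrow> ennreal"
  assumes X[measurable]: "X \<in> borel_measurable M"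
    and f[measurable]: "f \<in> borel_measurable F"
    and L: "prob_space L" "sets L = sets borel"
    and law: "\<And>B. B \<in> sets borel \<Longrightarrow> AE \<omega> in M. f \<omega> \<noteq> 0 \<longrightarrow>
       real_cond_exp M F (indicator {\<omega> \<in> space M. X \<omega> \<in> B}) \<omega> = measure L B"
    and g: "g \<in> borel_measurable borel"
  shows "(\<integral>\<^sup>+ \<omega>. f \<omega> * g (X \<omega>) \<partial>M) = (\<integral>\<^sup>+ \<omega>. f \<omega> \<partial>M) * (\<integral>\<^sup>+ x. g x \<partial>L)"
proof -
  interpret L: prob_space L by fact
  have fM[measurable]: "f \<in> borel_measurable M"
    by (rule measurable_from_subalg[OF subalg f])
  have "distr (density M f) borel X = scale_measure (\<integral>\<^sup>+ \<omega>. f \<omega> \<partial>M) L"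
  proof (rule measure_eqI)
    fix B assume "B \<in> sets (distr (density M f) borel X)"
    then have B[measurable]: "B \<in> sets borel" by simp
    let ?E = "{\<omega> \<in> space M. X \<omega> \<in> B}"
    have [measurable]: "?E \<in> sets M" by measurable
    \<comment> \<open>\<open>real_cond_exp\<close> is a difference of two \<open>enn2real\<close>
      terms. The bound by 1 makes the first one invertible, and the negative part of an indicator
      vanishes.\<close>
    have "AE \<omega> in M. nn_cond_exp M F (\<lambda>\<omega>. ennreal (indicator ?E \<omega>)) \<omega> \<le> nn_cond_exp M F (\<lambda>_. 1) \<omega>"
      by (rule nn_cond_exp_mono) (auto simp: indicator_def)
    moreover have "AE \<omega> in M. (1::ennreal) = nn_cond_exp M F (\<lambda>_. 1) \<omega>"
      by (rule nn_cond_exp_F_meas) auto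
    moreover have "AE \<omega> in M. nn_cond_exp M F (\<lambda>\<omega>. ennreal (- indicator ?E \<omega>)) \<omega> = nn_cond_exp M F (\<lambda>_. 0) \<omega>"
      by (rule nn_cond_exp_cong) (auto simp: indicator_def ennreal_neg)
    moreover have "AE \<omega> in M. (0::ennreal) = nn_cond_exp M F (\<lambda>_. 0) \<omega>"
      by (rule nn_cond_exp_F_meas) auto
    ultimately have "AE \<omega> in M. f \<omega> * nn_cond_exp M F (\<lambda>\<omega>. ennreal (indicator ?E \<omega>)) \<omega> = f \<omega> * emeasure L B"
      using law[OF B]
    proof eventually_elim
      case (elim \<omega>)
      show ?case
      proof (cases "f \<omega> = 0")
        case False
        let ?c = "nn_cond_exp M F (\<lambda>\<omega>. ennreal (indicator ?E \<omega>)) \<omega>"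
        have "enn2real ?c = measure L B"
          using elim False by (simp add: real_cond_exp_def)
        moreover have "?c < top" using elim(1,2) by (metis ennreal_one_less_top order_le_less_trans)
        ultimately have "?c = emeasure L B"
          by (metis L.emeasure_eq_measure ennreal_enn2real)
        then show ?thesis by simp
      qed simp
    qed
    then have eq: "(\<integral>\<^sup>+ \<omega>. f \<omega> * nn_cond_exp M F (\<lambda>\<omega>. ennreal (indicator ?E \<omega>)) \<omega> \<partial>M)
        = (\<integral>\<^sup>+ \<omega>. f \<omega> * emeasure L B \<partial>M)"
      by (rule nn_integral_cong_AE)
    have "emeasure (distr (density M f) borel X) B = emeasure (density M f) ?E"
      by (subst emeasure_distr) (auto simp: vimage_def Int_def conj_commute)
    also have "\<dots> = (\<integral>\<^sup>+ \<omega>. f \<omega> * ennreal (indicator ?E \<omega>) \<partial>M)"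
      by (subst emeasure_density) (auto intro!: nn_integral_cong simp: indicator_def)
    also have "\<dots> = (\<integral>\<^sup>+ \<omega>. f \<omega> * emeasure L B \<partial>M)"
      unfolding eq[symmetric] by (rule nn_cond_exp_intg[symmetric]) auto
    also have "\<dots> = (\<integral>\<^sup>+ \<omega>. f \<omega> \<partial>M) * emeasure L B"
      by (rule nn_integral_multc) auto
    finally show "emeasure (distr (density M f) borel X) B
        = emeasure (scale_measure (\<integral>\<^sup>+ \<omega>. f \<omega> \<partial>M) L) B"
      by simp
  qed (simp add: L)
  then have "(\<integral>\<^sup>+ x. g x \<partial>distr (density M f) borel X) = (\<integral>\<^sup>+ \<omega>. f \<omega> \<partial>M) * (\<integral>\<^sup>+ x. g x \<partial>L)"
    using g L by (simp add: nn_integral_scale_measure cong: measurable_cong_sets)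
  moreover have "(\<integral>\<^sup>+ x. g x \<partial>distr (density M f) borel X) = (\<integral>\<^sup>+ \<omega>. f \<omega> * g (X \<omega>) \<partial>M)"
    using g by (subst nn_integral_distr) (auto simp: nn_integral_density)
  ultimately show ?thesis by simp
qed

text \<open>The correction \<open>\<theta>\<^sup>2 / 8\<close> sits inside the exponent, so that the
  bound is exactly 1 and such factors can be multiplied over the visits.\<close>

lemma Hoeffdings_lemma_unit_interval:
  fixes \<theta> :: real
  assumes "prob_space L" and L: "sets L = sets borel" and AE: "AE x in L. x \<in> {0..1}"
  shows "(\<integral>\<^sup>+ x. ennreal (exp (\<theta> * (x - (\<integral>x. x \<partial>L)) - \<theta>\<^sup>2 / 8)) \<partial>L) \<le> 1"
proof -
  interpret prob_space L by fact
  have [measurable]: "(\<lambda>x. x) \<in> borel_measurable L" by (simp add: L cong: measurable_cong_sets)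
  define \<mu> where "\<mu> = (\<integral>x. x \<partial>L)"
  have *: "(\<integral>\<^sup>+ x. ennreal (exp (\<theta> * (x - \<mu>))) \<partial>L) \<le> ennreal (exp (\<theta>\<^sup>2 / 8))"
  proof -
    consider "\<theta> = 0" | "\<theta> > 0" | "- \<theta> > 0" by linarith
    then show ?thesis
    proof cases
      case 1
      then show ?thesis by (simp add: emeasure_space_1)
    next
      case 2
      interpret X: interval_bounded_random_variable L "\<lambda>x. x" 0 1
        by unfold_locales (use AE in auto)
      show ?thesis using X.Hoeffdings_lemma_nn_integral[OF 2] by (simp add: \<mu>_def)
    next
      case 3
      \<comment> \<open>Negative \<theta> is reduced to the positive case by reflection; the
        interval still has length 1, which keeps the constant 1/8.\<close>
      interpret X: interval_bounded_random_variable L "\<lambda>x. - x" "-1" 0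
        by unfold_locales (use AE in auto)
      show ?thesis using X.Hoeffdings_lemma_nn_integral[OF 3] by (simp add: \<mu>_def algebra_simps)
    qed
  qed
  have "(\<integral>\<^sup>+ x. ennreal (exp (\<theta> * (x - \<mu>) - \<theta>\<^sup>2 / 8)) \<partial>L)
      = (\<integral>\<^sup>+ x. ennreal (exp (\<theta> * (x - \<mu>))) * ennreal (exp (- (\<theta>\<^sup>2 / 8))) \<partial>L)"
    by (simp add: ennreal_mult'[symmetric] exp_add[symmetric])
  also have "\<dots> = (\<integral>\<^sup>+ x. ennreal (exp (\<theta> * (x - \<mu>))) \<partial>L) * ennreal (exp (- (\<theta>\<^sup>2 / 8)))"
    by (rule nn_integral_multc) measurable
  also have "\<dots> \<le> ennreal (exp (\<theta>\<^sup>2 / 8)) * ennreal (exp (- (\<theta>\<^sup>2 / 8)))"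
    by (rule mult_right_mono[OF *]) simp
  also have "\<dots> = 1"
    by (simp add: ennreal_mult'[symmetric] exp_add[symmetric])
  finally show ?thesis by (simp add: \<mu>_def)
qed

text \<open>\<open>step\<close> says that the conditional expectation of \<open>D n\<close> given
  \<open>G n\<close> is at most 1, tested against nonnegative weights. Taking the product of all
  earlier factors as the weight removes the last factor, and induction removes the others.\<close>

lemma (in prob_space) nn_integral_prod_supermartingale_le_1:
  fixes D :: "nat \<Rightarrow> 'a \<Rightarrow> ennreal"
  assumes step: "\<And>n f. w \<le> n \<Longrightarrow> n \<le> t \<Longrightarrow> f \<in> borel_measurable (G n) \<Longrightarrow>
      (\<integral>\<^sup>+ \<omega>. f \<omega> * D n \<omega> \<partial>M) \<le> (\<integral>\<^sup>+ \<omega>. f \<omega> \<partial>M)"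
    and adapted: "\<And>k n. w \<le> k \<Longrightarrow> k < n \<Longrightarrow> n \<le> t \<Longrightarrow> D k \<in> borel_measurable (G n)"
  shows "(\<integral>\<^sup>+ \<omega>. (\<Prod>l=w..t. D l \<omega>) \<partial>M) \<le> 1"
  using assms
proof (induction t)
  case 0
  show ?case
  proof (cases "w = 0")
    case True
    then show ?thesis using "0.prems"(1)[of 0 "\<lambda>_. 1"] by (simp add: emeasure_space_1)
  qed (simp add: emeasure_space_1)
next
  case (Suc t)
  show ?case
  proof (cases "w \<le> Suc t")
    case True
    then have "(\<integral>\<^sup>+ \<omega>. (\<Prod>l=w..Suc t. D l \<omega>) \<partial>M) = (\<integral>\<^sup>+ \<omega>. (\<Prod>l=w..t. D l \<omega>) * D (Suc t) \<omega> \<partial>M)"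
      by (simp add: prod.nat_ivl_Suc')
    also have "\<dots> \<le> (\<integral>\<^sup>+ \<omega>. (\<Prod>l=w..t. D l \<omega>) \<partial>M)"
      by (rule Suc.prems(1)[OF True order_refl], rule borel_measurable_prod_ennreal)
         (use Suc.prems(2) in auto)
    also have "\<dots> \<le> 1"
      by (rule Suc.IH) (use Suc.prems in auto)
    finally show ?thesis .
  qed (simp add: emeasure_space_1)
qed

lemma subalgebra_trans:
  "subalgebra A B \<Longrightarrow> subalgebra B C \<Longrightarrow> subalgebra A C"
  by (auto simp: subalgebra_def)

section \<open>The order of information across steps and episodes\<close>

context cmdp_stochastic_thresholds
begin

abbreviation visit :: "nat \<Rightarrow> nat \<Rightarrow> 's \<Rightarrow> 'a \<Rightarrow> 'w \<Rightarrow> bool" where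
  "visit h l s a \<omega> \<equiv> st l h \<omega> = s \<and> ac l h \<omega> = a"

lemma
  assumes "l \<in> {1..T}" "h \<in> {1..H}"
  shows subalgebra_FA_FS: "subalgebra (FA l h) (FS l h)"
    and subalgebra_FO_FA: "subalgebra (FO l h) (FA l h)"
    and subalgebra_M_FA: "subalgebra M (FA l h)"
  using filtration[OF assms] by (auto simp: subalgebra_def)

lemma subalgebra_FS_mono:
  assumes "l \<in> {1..T}" "1 \<le> h" "h \<le> k" "k \<le> H"
  shows "subalgebra (FS l k) (FS l h)"
  using assms(3,4)
proof (induction k rule: dec_induct)
  case base
  show ?case by (simp add: subalgebra_def)
next
  case (step k)
  have k: "k \<in> {1..H}" "k \<in> {1..<H}" using assms(2) step by auto
  show ?case
    using filtration_step[OF assms(1) k(2)] filtration[OF assms(1) k(1)] step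
    by (meson Suc_leD subalgebra_trans)
qed

text \<open>Information is passed to the end of episode \<open>l\<close>, over to the start of the
  next one, and forward again to step \<open>h\<close>.\<close>

lemma subalgebra_FS_Suc_FO:
  assumes l: "l \<in> {1..<T}" and h: "h \<in> {1..H}"
  shows "subalgebra (FS (Suc l) h) (FO l h)"
proof -
  have "subalgebra (FO l H) (FO l h)"
  proof (cases "h = H")
    case False
    then have "subalgebra (FS l (Suc h)) (FO l h)" "subalgebra (FS l H) (FS l (Suc h))"
      using l h by (auto intro!: filtration_step subalgebra_FS_mono)
    then show ?thesis
      using filtration[of l H] l h
      by (meson atLeastAtMost_iff atLeastLessThan_iff dual_order.trans less_imp_le order_refl
          subalgebra_trans)
  qed (simp add: subalgebra_def)
  moreover have "subalgebra (FS (Suc l) 1) (FO l H)"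
    using filtration_episode l h by simp
  moreover have "subalgebra (FS (Suc l) h) (FS (Suc l) 1)"
    using l h by (intro subalgebra_FS_mono) auto
  ultimately show ?thesis by (meson subalgebra_trans)
qed

text \<open>For a fixed step \<open>h\<close>, the algebras \<open>FA 1 h\<close>,
  \<open>FO 1 h\<close>, \<open>FA 2 h\<close>, ... thus increase; the concentration argument runs
  along this filtration, with episodes as time.\<close>

lemma subalgebra_FA_FO:
  assumes h: "h \<in> {1..H}" and "1 \<le> k" "k < l" "l \<le> T"
  shows "subalgebra (FA l h) (FO k h)"
proof -
  have Suc: "subalgebra (FA (Suc l) h) (FO l h)" if "l \<in> {1..<T}" for l
    using subalgebra_trans[OF subalgebra_FA_FS subalgebra_FS_Suc_FO[OF that h]] that h by simp
  have "Suc k \<le> l" using assms by simp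
  then show ?thesis using assms(4)
  proof (induction l rule: dec_induct)
    case base
    then show ?case using Suc[of k] assms by simp
  next
    case (step l)
    then have "subalgebra (FA l h) (FO k h)" by simp
    moreover have "subalgebra (FO l h) (FA l h)" using subalgebra_FO_FA[OF _ h] step by simp
    moreover have "subalgebra (FA (Suc l) h) (FO l h)" using Suc[of l] step assms by simp
    ultimately show ?case by (meson subalgebra_trans)
  qed
qed

lemma visit_measurable_FA:
  assumes "l \<in> {1..T}" "h \<in> {1..H}"
  shows "Measurable.pred (FA l h) (visit h l s a)"
proof -
  have [measurable]: "st l h \<in> measurable (FA l h) (count_space UNIV)"
      "ac l h \<in> measurable (FA l h) (count_space UNIV)"
    using measurable_from_subalg[OF subalgebra_FA_FS state_measurable] action_measurable assms by auto
  show ?thesis by measurable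
qed

lemma visit_measurable:
  assumes "l \<in> {1..T}" "h \<in> {1..H}"
  shows "Measurable.pred M (visit h l s a)"
  using measurable_from_subalg[OF subalgebra_M_FA visit_measurable_FA] assms by auto

section \<open>The law of the observed signals\<close>

text \<open>The visit indicator belongs to the weight because \<open>signal_law\<close> prescribes
  the law of a signal only where its pair is visited.\<close>

lemma nn_integral_signal:
  assumes i: "i \<in> {1..m}" and h: "h \<in> {1..H}" and l: "l \<in> {1..T}"
    and f[measurable]: "f \<in> borel_measurable (FA l h)" and g[measurable]: "g \<in> borel_measurable borel"
  shows "(\<integral>\<^sup>+ \<omega>. f \<omega> * of_bool (visit h l s a \<omega>) * g (sig i h l s a \<omega>) \<partial>M)
      = (\<integral>\<^sup>+ \<omega>. f \<omega> * of_bool (visit h l s a \<omega>) \<partial>M) * (\<integral>\<^sup>+ x. g x \<partial>\<L> i h)"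
proof -
  interpret finite_measure_subalgebra M "FA l h"
    by unfold_locales (rule subalgebra_M_FA[OF l h])
  note [measurable] = visit_measurable_FA[OF l h]
  show ?thesis
  proof (rule nn_integral_mult_cond_law)
    show "sig i h l s a \<in> borel_measurable M" using signal_measurable i h l by simp
    show "(\<lambda>\<omega>. f \<omega> * of_bool (visit h l s a \<omega>)) \<in> borel_measurable (FA l h)"
      by measurable
    show "prob_space (\<L> i h)" "sets (\<L> i h) = sets borel" using threshold_law[OF i h] by auto
    show "AE \<omega> in M. f \<omega> * of_bool (visit h l s a \<omega>) \<noteq> 0 \<longrightarrow>
       real_cond_exp M (FA l h) (indicator {\<omega> \<in> space M. sig i h l s a \<omega> \<in> B}) \<omega> = measure (\<L> i h) B"
      if "B \<in> sets borel" for B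
      using signal_law[OF i h l that, of s a] by eventually_elim auto
  qed fact
qed

text \<open>Take the indicator of the complement of [0,1] as the test function: it has integral 0
  under \<open>\<L> i h\<close>.\<close>

lemma AE_signal_unit_interval:
  assumes i: "i \<in> {1..m}" and h: "h \<in> {1..H}" and l: "l \<in> {1..T}"
  shows "AE \<omega> in M. visit h l s a \<omega> \<longrightarrow> sig i h l s a \<omega> \<in> {0..1}"
proof -
  note [measurable] = visit_measurable[OF l h] signal_measurable[OF i h l]
  have sets[measurable_cong]: "sets (\<L> i h) = sets borel" using threshold_law[OF i h] by auto
  have "(\<integral>\<^sup>+ x. indicator (- {0..1::real}) x \<partial>\<L> i h) = 0"
    using threshold_law[OF i h] by (subst nn_integral_0_iff_AE) auto
  then have "(\<integral>\<^sup>+ \<omega>. 1 * of_bool (visit h l s a \<omega>) * indicator (- {0..1}) (sig i h l s a \<omega>) \<partial>M) = 0"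
    using nn_integral_signal[OF i h l, of "\<lambda>_. 1" "indicator (- {0..1})" s a] by simp
  then have "AE \<omega> in M. 1 * of_bool (visit h l s a \<omega>) * (indicator (- {0..1}) (sig i h l s a \<omega>) :: ennreal) = 0"
    by (subst (asm) nn_integral_0_iff_AE) auto
  then show ?thesis
    by eventually_elim (auto simp: indicator_def split: if_splits)
qed

section \<open>The exponential supermartingale\<close>

text \<open>The visit indicator multiplies the whole exponent: an episode without a visit
  contributes the factor 1, and the penalty \<open>\<theta>\<^sup>2 / 8\<close> is charged once per
  visit.\<close>

definition signal_factor :: "real \<Rightarrow> nat \<Rightarrow> nat \<Rightarrow> 's \<Rightarrow> 'a \<Rightarrow> nat \<Rightarrow> 'w \<Rightarrow> real" where
  "signal_factor \<theta> i h s a l \<omega> =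
     exp (of_bool (visit h l s a \<omega>) * (\<theta> * (sig i h l s a \<omega> - \<alpha> i h) - \<theta>\<^sup>2 / 8))"

lemma signal_factor_measurable:
  assumes i: "i \<in> {1..m}" and h: "h \<in> {1..H}" and l: "l \<in> {1..T}"
  shows "signal_factor \<theta> i h s a l \<in> borel_measurable (FO l h)"
proof -
  note [measurable] = measurable_from_subalg[OF subalgebra_FO_FA[OF l h] visit_measurable_FA[OF l h]]
    observed_signal_measurable[OF i h l]
  \<comment> \<open>The signal of a fixed pair need not be \<open>FO\<close>-measurable, only the
    observed one is. The two agree on a visit, and elsewhere the exponent is 0.\<close>
  have "signal_factor \<theta> i h s a l = (\<lambda>\<omega>. exp (of_bool (visit h l s a \<omega>) *
      (\<theta> * (sig i h l (st l h \<omega>) (ac l h \<omega>) \<omega> - \<alpha> i h) - \<theta>\<^sup>2 / 8)))"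
    by (auto simp: signal_factor_def fun_eq_iff)
  then show ?thesis by simp
qed

text \<open>Split according to whether the pair is visited: on a visit the conditional law is
  \<open>\<L> i h\<close> and Hoeffding's lemma applies, otherwise the factor is 1.\<close>

lemma nn_integral_signal_factor_le:
  assumes i: "i \<in> {1..m}" and h: "h \<in> {1..H}" and l: "l \<in> {1..T}"
    and f: "f \<in> borel_measurable (FA l h)"
  shows "(\<integral>\<^sup>+ \<omega>. f \<omega> * ennreal (signal_factor \<theta> i h s a l \<omega>) \<partial>M) \<le> (\<integral>\<^sup>+ \<omega>. f \<omega> \<partial>M)"
proof -
  note [measurable] = visit_measurable[OF l h] signal_measurable[OF i h l]
    measurable_from_subalg[OF subalgebra_M_FA[OF l h] f]
  let ?g = "\<lambda>x. ennreal (exp (\<theta> * (x - \<alpha> i h) - \<theta>\<^sup>2 / 8))"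
  have "(\<integral>\<^sup>+ \<omega>. f \<omega> * ennreal (signal_factor \<theta> i h s a l \<omega>) \<partial>M)
     = (\<integral>\<^sup>+ \<omega>. f \<omega> * of_bool (visit h l s a \<omega>) * ?g (sig i h l s a \<omega>)
              + f \<omega> * of_bool (\<not> visit h l s a \<omega>) \<partial>M)"
    by (intro nn_integral_cong) (auto simp: signal_factor_def)
  also have "\<dots> = (\<integral>\<^sup>+ \<omega>. f \<omega> * of_bool (visit h l s a \<omega>) * ?g (sig i h l s a \<omega>) \<partial>M)
              + (\<integral>\<^sup>+ \<omega>. f \<omega> * of_bool (\<not> visit h l s a \<omega>) \<partial>M)"
    by (rule nn_integral_add) measurable
  also have "(\<integral>\<^sup>+ \<omega>. f \<omega> * of_bool (visit h l s a \<omega>) * ?g (sig i h l s a \<omega>) \<partial>M)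
      = (\<integral>\<^sup>+ \<omega>. f \<omega> * of_bool (visit h l s a \<omega>) \<partial>M) * (\<integral>\<^sup>+ x. ?g x \<partial>\<L> i h)"
    by (rule nn_integral_signal[OF i h l f]) measurable
  also have "\<dots> \<le> (\<integral>\<^sup>+ \<omega>. f \<omega> * of_bool (visit h l s a \<omega>) \<partial>M) * 1"
    using Hoeffdings_lemma_unit_interval[of "\<L> i h" \<theta>] threshold_law[OF i h] threshold_mean[OF i h]
    by (intro mult_left_mono) auto
  also have "(\<integral>\<^sup>+ \<omega>. f \<omega> * of_bool (visit h l s a \<omega>) \<partial>M) * 1
        + (\<integral>\<^sup>+ \<omega>. f \<omega> * of_bool (\<not> visit h l s a \<omega>) \<partial>M)
      = (\<integral>\<^sup>+ \<omega>. f \<omega> * of_bool (visit h l s a \<omega>) + f \<omega> * of_bool (\<not> visit h l s a \<omega>) \<partial>M)"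
    unfolding mult_1_right by (rule nn_integral_add[symmetric]) measurable
  also have "\<dots> = (\<integral>\<^sup>+ \<omega>. f \<omega> \<partial>M)"
    by (intro nn_integral_cong) auto
  finally show ?thesis by (simp add: add_right_mono)
qed

lemma nn_integral_prod_signal_factor_le_1:
  assumes i: "i \<in> {1..m}" and h: "h \<in> {1..H}" and t: "t \<le> T" and w: "1 \<le> w"
  shows "(\<integral>\<^sup>+ \<omega>. (\<Prod>l=w..t. ennreal (signal_factor \<theta> i h s a l \<omega>)) \<partial>M) \<le> 1"
proof (rule nn_integral_prod_supermartingale_le_1[where G = "\<lambda>l. FA l h"])
  show "(\<integral>\<^sup>+ \<omega>. f \<omega> * ennreal (signal_factor \<theta> i h s a n \<omega>) \<partial>M) \<le> (\<integral>\<^sup>+ \<omega>. f \<omega> \<partial>M)"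
    if "w \<le> n" "n \<le> t" "f \<in> borel_measurable (FA n h)" for n f
    using that nn_integral_signal_factor_le[OF i h] t w by simp
next
  fix k n assume "w \<le> k" "k < n" "n \<le> t"
  then have "signal_factor \<theta> i h s a k \<in> borel_measurable (FA n h)"
    using measurable_from_subalg[OF subalgebra_FA_FO signal_factor_measurable] i h t w by simp
  then show "(\<lambda>\<omega>. ennreal (signal_factor \<theta> i h s a k \<omega>)) \<in> borel_measurable (FA n h)"
    by simp
qed

section \<open>Tail bound for a fixed number of visits\<close>

definition signal_deviation :: "nat \<Rightarrow> nat \<Rightarrow> nat \<Rightarrow> nat \<Rightarrow> 's \<Rightarrow> 'a \<Rightarrow> 'w \<Rightarrow> real" where
  "signal_deviation i h w t s a \<omega> =
     (\<Sum>l=w..t. of_bool (visit h l s a \<omega>) * (sig i h l s a \<omega> - \<alpha> i h))"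

definition visits :: "nat \<Rightarrow> nat \<Rightarrow> nat \<Rightarrow> 's \<Rightarrow> 'a \<Rightarrow> 'w \<Rightarrow> nat" where
  "visits h w t s a \<omega> = (\<Sum>l=w..t. of_bool (visit h l s a \<omega>))"

lemma
  assumes "h \<in> {1..H}" "t \<le> T" "1 \<le> w"
  shows visits_measurable: "visits h w t s a \<in> measurable M (count_space UNIV)"
    and signal_deviation_measurable:
      "i \<in> {1..m} \<Longrightarrow> signal_deviation i h w t s a \<in> borel_measurable M"
proof -
  have l: "l \<in> {1..T}" if "l \<in> {w..t}" for l using that assms by auto
  have [measurable]: "Measurable.pred M (visit h l s a)" if "l \<in> {w..t}" for l
    using visit_measurable[OF l[OF that] assms(1)] .
  show "visits h w t s a \<in> measurable M (count_space UNIV)"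
    unfolding visits_def by measurable
  show "signal_deviation i h w t s a \<in> borel_measurable M" if i: "i \<in> {1..m}"
    unfolding signal_deviation_def
  proof (rule borel_measurable_sum)
    fix l assume "l \<in> {w..t}"
    note [measurable] = visit_measurable[OF l[OF this] assms(1)] signal_measurable[OF i assms(1) l[OF this]]
    show "(\<lambda>\<omega>. of_bool (visit h l s a \<omega>) * (sig i h l s a \<omega> - \<alpha> i h)) \<in> borel_measurable M"
      by measurable
  qed
qed

lemma prod_signal_factor:
  "(\<Prod>l=w..t. signal_factor \<theta> i h s a l \<omega>)
     = exp (\<theta> * signal_deviation i h w t s a \<omega> - \<theta>\<^sup>2 / 8 * real (visits h w t s a \<omega>))"
proof -
  have "(\<Prod>l=w..t. signal_factor \<theta> i h s a l \<omega>)
      = exp (\<Sum>l=w..t. of_bool (visit h l s a \<omega>) * (\<theta> * (sig i h l s a \<omega> - \<alpha> i h) - \<theta>\<^sup>2 / 8))"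
    unfolding signal_factor_def by (rule exp_sum[symmetric]) simp
  also have "(\<Sum>l=w..t. of_bool (visit h l s a \<omega>) * (\<theta> * (sig i h l s a \<omega> - \<alpha> i h) - \<theta>\<^sup>2 / 8))
     = \<theta> * signal_deviation i h w t s a \<omega> - \<theta>\<^sup>2 / 8 * real (visits h w t s a \<omega>)"
    unfolding signal_deviation_def visits_def of_nat_sum of_nat_of_bool sum_distrib_left sum_subtractf[symmetric]
    by (intro sum.cong) (auto simp: algebra_simps)
  finally show ?thesis .
qed

text \<open>The sign \<open>c\<close> selects the upper or the lower tail.\<close>

lemma prob_signal_deviation_ge:
  assumes i: "i \<in> {1..m}" and h: "h \<in> {1..H}" and t: "t \<le> T" and w: "1 \<le> w"
    and c: "\<bar>c\<bar> = 1" and \<epsilon>: "0 \<le> \<epsilon>"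
  shows "prob {\<omega> \<in> space M. visits h w t s a \<omega> = n \<and> c * signal_deviation i h w t s a \<omega> \<ge> \<epsilon> * n}
      \<le> exp (- 2 * \<epsilon>\<^sup>2 * n)" (is "prob ?E \<le> _")
proof -
  note [measurable] = visits_measurable[OF h t w] signal_deviation_measurable[OF h t w i]
  \<comment> \<open>\<open>4 \<epsilon>\<close> maximises \<open>\<theta> \<epsilon> - \<theta>\<^sup>2 / 8\<close>.\<close>
  define \<theta> where "\<theta> = 4 * \<epsilon> * c"
  define u where "u \<omega> = ennreal (\<Prod>l=w..t. signal_factor \<theta> i h s a l \<omega>)" for \<omega>
  have [measurable]: "u \<in> borel_measurable M"
    unfolding u_def prod_signal_factor by measurable
  have sq: "\<theta>\<^sup>2 = 16 * \<epsilon>\<^sup>2"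
    using c by (auto simp: \<theta>_def power_mult_distrib abs_if split: if_splits)
  \<comment> \<open>On \<open>?E\<close> the exponent of \<open>u\<close> is at least
    \<open>4 * \<epsilon>\<^sup>2 * n - 2 * \<epsilon>\<^sup>2 * n\<close>, so Markov's inequality
    applies to \<open>u\<close> at level \<open>exp (2 * \<epsilon>\<^sup>2 * n)\<close>.\<close>
  have "?E \<subseteq> {\<omega> \<in> space M. 1 \<le> ennreal (exp (- 2 * \<epsilon>\<^sup>2 * n)) * u \<omega>}"
  proof safe
    fix \<omega> assume n: "n = visits h w t s a \<omega>"
      and d: "c * signal_deviation i h w t s a \<omega> \<ge> \<epsilon> * real (visits h w t s a \<omega>)"
    have "4 * \<epsilon> * (\<epsilon> * n) \<le> 4 * \<epsilon> * (c * signal_deviation i h w t s a \<omega>)"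
      using d \<epsilon> n by (intro mult_left_mono) auto
    then have "0 \<le> - 2 * \<epsilon>\<^sup>2 * n + (\<theta> * signal_deviation i h w t s a \<omega> - \<theta>\<^sup>2 / 8 * n)"
      unfolding sq by (simp add: \<theta>_def power2_eq_square algebra_simps)
    then have "1 \<le> exp (- 2 * \<epsilon>\<^sup>2 * n) * exp (\<theta> * signal_deviation i h w t s a \<omega> - \<theta>\<^sup>2 / 8 * n)"
      unfolding exp_add[symmetric] by (simp del: mult_minus_left)
    then show "1 \<le> ennreal (exp (- 2 * \<epsilon>\<^sup>2 * visits h w t s a \<omega>)) * u \<omega>"
      unfolding u_def prod_signal_factor n
      by (subst ennreal_mult'[symmetric]) auto
  qed
  then have "emeasure M ?E \<le> emeasure M {\<omega> \<in> space M. 1 \<le> ennreal (exp (- 2 * \<epsilon>\<^sup>2 * n)) * u \<omega>}"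
    by (rule emeasure_mono) measurable
  also have "\<dots> \<le> ennreal (exp (- 2 * \<epsilon>\<^sup>2 * n)) * (\<integral>\<^sup>+ \<omega>. u \<omega> * indicator (space M) \<omega> \<partial>M)"
    by (rule nn_integral_Markov_inequality) auto
  also have "(\<integral>\<^sup>+ \<omega>. u \<omega> * indicator (space M) \<omega> \<partial>M) = (\<integral>\<^sup>+ \<omega>. u \<omega> \<partial>M)"
    by (intro nn_integral_cong) auto
  also have "\<dots> = (\<integral>\<^sup>+ \<omega>. (\<Prod>l=w..t. ennreal (signal_factor \<theta> i h s a l \<omega>)) \<partial>M)"
    unfolding u_def by (intro nn_integral_cong prod_ennreal[symmetric]) (simp add: signal_factor_def)
  also have "ennreal (exp (- 2 * \<epsilon>\<^sup>2 * n)) * \<dots> \<le> ennreal (exp (- 2 * \<epsilon>\<^sup>2 * n)) * 1"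
    by (intro mult_left_mono nn_integral_prod_signal_factor_le_1 assms) auto
  finally show ?thesis by (simp add: emeasure_eq_measure)
qed

lemma visits_le: "visits h w t s a \<omega> \<le> Suc t - w"
proof -
  have "visits h w t s a \<omega> \<le> (\<Sum>l=w..t. 1)"
    unfolding visits_def by (rule sum_mono) auto
  then show ?thesis by simp
qed

end

section \<open>Numerical bounds for the confidence radius\<close>

text \<open>The first bound makes the radius 1 when there are no visits; the second is the budget of
  the union bound. For the latter put \<open>r = \<delta> / K\<close>: two of the eight powers of
  \<open>r\<close> cancel \<open>K * K\<close> and leave \<open>\<delta> * \<delta>\<close>, and the
  other six absorb the factor 2.\<close>

lemma ln_card_bounds:
  fixes \<delta> :: real and K :: nat
  assumes \<delta>: "0 < \<delta>" "\<delta> < 1" and K: "1 \<le> K" and nondeg: "K \<noteq> 1 \<or> \<delta> \<le> exp (- 1 / 4)"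
  shows "1 \<le> 4 * ln (real K / \<delta>)"
    and "T \<le> K \<Longrightarrow> 2 * real K * real T * exp (- 8 * ln (real K / \<delta>)) \<le> \<delta>"
proof -
  have ln_K: "ln (real K / \<delta>) = ln (real K) - ln \<delta>"
    using \<delta> K by (simp add: ln_div)
  show L: "1 \<le> 4 * ln (real K / \<delta>)"
  proof (cases "K = 1")
    case True
    then have "ln \<delta> \<le> - 1 / 4" using nondeg \<delta> by (metis ln_exp ln_le_cancel_iff exp_gt_zero)
    then show ?thesis using True ln_K by simp
  next
    case False
    \<comment> \<open>For \<open>K \<ge> 2\<close> this crude estimate already gives
      \<open>4 * ln K \<ge> 2\<close>; only \<open>K = 1\<close> relies on the size of
      \<delta>.\<close>
    have "1 / 2 \<le> ln (2::real)" using ln_diff_le[of 1 2] by simp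
    also have "\<dots> \<le> ln (real K)" using False K by simp
    finally have "1 / 2 \<le> ln (real K)" .
    moreover have "ln \<delta> < 0" using \<delta> by simp
    ultimately show ?thesis unfolding ln_K by argo
  qed
  define r where "r = \<delta> / real K"
  have r: "0 < r" "r = exp (- ln (real K / \<delta>))"
    using \<delta> K by (auto simp: r_def exp_minus)
  have r8: "exp (- 8 * ln (real K / \<delta>)) = r ^ 8"
    unfolding r(2) by (simp add: exp_of_nat_mult[symmetric])
  have Kr: "real K * r = \<delta>" using K by (simp add: r_def)
  assume "T \<le> K"
  then have "2 * real K * real T * r ^ 8 \<le> 2 * real K * real K * r ^ 8"
    using r by (intro mult_right_mono mult_left_mono) auto
  also have "\<dots> = \<delta> * \<delta> * (2 * r ^ 6)"
    unfolding Kr[symmetric] by (simp add: power_numeral_reduce)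
  also have "\<dots> \<le> \<delta> * 1 * 1"
  proof (intro mult_mono)
    have "r ^ 6 = exp (- 6 * ln (real K / \<delta>))"
      unfolding r(2) by (simp add: exp_of_nat_mult[symmetric])
    also have "\<dots> \<le> exp (- 1)" using L by simp
    also have "\<dots> \<le> 1 / 2" using exp_ge_add_one_self[of 1] by (simp add: exp_minus field_simps)
    finally show "2 * r ^ 6 \<le> 1" by simp
  qed (use \<delta> r in auto)
  finally show "2 * real K * real T * exp (- 8 * ln (real K / \<delta>)) \<le> \<delta>" unfolding r8 by simp
qed

section \<open>From the tail bound to the simultaneous confidence bound\<close>

context cmdp_stochastic_thresholds
begin

text \<open>Fixing the count \<open>n\<close> turns the random radius into the number
  \<open>sqrt (x / n)\<close>; the inequality is multiplied by \<open>n\<close> to speak of sums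
  instead of means.\<close>

definition deviation_event :: "(nat \<Rightarrow> nat) \<Rightarrow> real \<Rightarrow> nat \<Rightarrow> nat \<Rightarrow> nat \<Rightarrow> 's \<Rightarrow> 'a \<Rightarrow> nat \<Rightarrow> real \<Rightarrow> 'w set" where
  "deviation_event W x i h t s a n c =
     {\<omega> \<in> space M. visits h (window_start W t) t s a \<omega> = n \<and>
        c * signal_deviation i h (window_start W t) t s a \<omega> \<ge> sqrt (x / n) * n}"

lemma deviation_event_sets:
  assumes i: "i \<in> {1..m}" and h: "h \<in> {1..H}" and t: "t \<in> {1..T}"
  shows "deviation_event W x i h t s a n c \<in> sets M"
proof -
  have t: "t \<le> T" and w: "1 \<le> window_start W t" using t by (auto simp: window_start_def)
  note [measurable] = visits_measurable[OF h t w] signal_deviation_measurable[OF h t w i]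
  show ?thesis unfolding deviation_event_def by measurable
qed

text \<open>With \<open>\<epsilon> = sqrt (x / n)\<close> the product
  \<open>\<epsilon>\<^sup>2 * n\<close> is \<open>x\<close>, so the bound is the same for every
  count.\<close>

lemma prob_deviation_event:
  assumes "i \<in> {1..m}" "h \<in> {1..H}" "t \<in> {1..T}" "\<bar>c\<bar> = 1" "0 \<le> x" "1 \<le> n"
  shows "prob (deviation_event W x i h t s a n c) \<le> exp (- 2 * x)"
proof -
  have "prob (deviation_event W x i h t s a n c) \<le> exp (- 2 * (sqrt (x / n))\<^sup>2 * n)"
    unfolding deviation_event_def using assms
    by (intro prob_signal_deviation_ge) (auto simp: window_start_def)
  then show ?thesis using assms by simp
qed

lemma alpha_hat_minus_alpha:
  assumes "visits h (window_start W t) t s a \<omega> \<noteq> 0"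
  shows "alpha_hat W st ac sig i h t s a \<omega> - \<alpha> i h
     = signal_deviation i h (window_start W t) t s a \<omega> / visits h (window_start W t) t s a \<omega>"
proof -
  let ?w = "window_start W t"
  have "signal_deviation i h ?w t s a \<omega> =
     (\<Sum>l=?w..t. sig i h l s a \<omega> * of_bool (visit h l s a \<omega>)) - \<alpha> i h * visits h ?w t s a \<omega>"
    unfolding signal_deviation_def visits_def of_nat_sum of_nat_of_bool sum_distrib_left sum_subtractf[symmetric]
    by (intro sum.cong) (auto simp: algebra_simps)
  moreover have "visit_count W st ac h t t s a \<omega> = visits h ?w t s a \<omega>"
    by (simp add: visit_count_def visits_def)
  ultimately show ?thesis
    using assms by (simp add: alpha_hat_def max_def field_simps)
qed

lemma threshold_mean_bounds:
  assumes "i \<in> {1..m}" "h \<in> {1..H}"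
  shows "0 \<le> \<alpha> i h" "\<alpha> i h \<le> 1"
proof -
  interpret L: prob_space "\<L> i h" using threshold_law[OF assms] by simp
  have AE: "AE x in \<L> i h. x \<in> {0..1}" and sets: "sets (\<L> i h) = sets borel"
    using threshold_law[OF assms] by auto
  have AE0: "AE x in \<L> i h. 0 \<le> x" and AE1: "AE x in \<L> i h. x \<le> 1" and AE2: "AE x in \<L> i h. norm x \<le> 1"
    using AE by (eventually_elim; simp)+
  have [measurable]: "(\<lambda>x. x) \<in> borel_measurable (\<L> i h)"
    by (simp add: sets cong: measurable_cong_sets)
  have int: "integrable (\<L> i h) (\<lambda>x. x)"
    by (rule L.integrable_const_bound[where B = 1]) (use AE2 in auto)
  show "0 \<le> \<alpha> i h" "\<alpha> i h \<le> 1"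
    unfolding threshold_mean[OF assms]
    using AE0 AE1 by (auto intro!: integral_nonneg_AE L.integral_le_const int)
qed

text \<open>The numerator lies between 0 and the number of visits; an empty window gives the value
  0.\<close>

lemma alpha_hat_bounds:
  assumes "\<And>l. l \<in> {1..T} \<Longrightarrow> visit h l s a \<omega> \<Longrightarrow> sig i h l s a \<omega> \<in> {0..1}" "t \<le> T"
  shows "0 \<le> alpha_hat W st ac sig i h t s a \<omega>" "alpha_hat W st ac sig i h t s a \<omega> \<le> 1"
proof -
  let ?w = "window_start W t"
  have l: "l \<in> {1..T}" if "l \<in> {?w..t}" for l using that assms by (auto simp: window_start_def)
  have "0 \<le> (\<Sum>l=?w..t. sig i h l s a \<omega> * of_bool (visit h l s a \<omega>))"
    using assms(1)[OF l] by (intro sum_nonneg) auto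
  then show "0 \<le> alpha_hat W st ac sig i h t s a \<omega>" by (simp add: alpha_hat_def)
  have "(\<Sum>l=?w..t. sig i h l s a \<omega> * of_bool (visit h l s a \<omega>))
      \<le> (\<Sum>l=?w..t. of_bool (visit h l s a \<omega>))"
    using assms(1)[OF l] by (intro sum_mono) auto
  also have "\<dots> = real (visit_count W st ac h t t s a \<omega>)" by (simp add: visit_count_def)
  also have "\<dots> \<le> real (max 1 (visit_count W st ac h t t s a \<omega>))" by simp
  finally show "alpha_hat W st ac sig i h t s a \<omega> \<le> 1"
    unfolding alpha_hat_def by (subst divide_le_eq_1_pos) auto
qed

text \<open>This is the pointwise part of the argument: the witnesses are the actual visit count of
  the window and the sign of the deviation.\<close>

lemma zeta_exceeded_imp_deviation_event:
  fixes \<delta> :: real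
  defines "x \<equiv> 4 * ln (real (m * CARD('s) * CARD('a) * H * T) / \<delta>)"
  assumes i: "i \<in> {1..m}" and h: "h \<in> {1..H}" and t: "t \<in> {1..T}" and \<omega>: "\<omega> \<in> space M"
    and sig: "\<And>l. l \<in> {1..T} \<Longrightarrow> visit h l s a \<omega> \<Longrightarrow> sig i h l s a \<omega> \<in> {0..1}"
    and x: "1 \<le> x"
    and exceed: "\<bar>alpha_hat W st ac sig i h t s a \<omega> - \<alpha> i h\<bar> > zeta m H T \<delta> W st ac h t s a \<omega>"
  shows "\<exists>n\<in>{1..T}. \<exists>c\<in>{- 1, 1}. \<omega> \<in> deviation_event W x i h t s a n c"
proof -
  let ?w = "window_start W t"
  let ?n = "visits h ?w t s a \<omega>"
  let ?n' = "visit_count W st ac h t (t - 1) s a \<omega>"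
  \<comment> \<open>Estimate and mean both lie in [0,1], so an error above the minimum must exceed
    its square root term.\<close>
  have le1: "\<bar>alpha_hat W st ac sig i h t s a \<omega> - \<alpha> i h\<bar> \<le> 1"
  proof -
    have "t \<le> T" using t by simp
    note alpha_hat_bounds[OF sig this, of W]
    then show ?thesis using threshold_mean_bounds[OF i h] by linarith
  qed
  with exceed have gt: "\<bar>alpha_hat W st ac sig i h t s a \<omega> - \<alpha> i h\<bar> > sqrt (x / real (max 1 ?n'))"
    unfolding zeta_def x_def by linarith
  have n': "?n' \<le> ?n"
    unfolding visit_count_def visits_def by (rule sum_mono2) auto
  have n: "?n \<noteq> 0"
  proof
    assume "?n = 0"
    then have "max 1 ?n' = 1" using n' by simp
    then have "sqrt (x / real (max 1 ?n')) \<ge> 1" using x by simp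
    then show False using gt le1 by linarith
  qed
  \<comment> \<open>Passing from the count up to \<open>t - 1\<close> to the larger count up to
    \<open>t\<close> shrinks the radius, so the exceedance persists.\<close>
  have "sqrt (x / ?n) \<le> sqrt (x / real (max 1 ?n'))"
    using n n' x by (intro real_sqrt_le_mono divide_left_mono) auto
  also note gt
  finally have "sqrt (x / ?n) * ?n \<le> \<bar>signal_deviation i h ?w t s a \<omega>\<bar>"
    using n by (simp add: alpha_hat_minus_alpha field_simps)
  moreover have "?n \<in> {1..T}"
    using n visits_le[of h ?w t s a \<omega>] t by (auto simp: window_start_def)
  ultimately show ?thesis
    using \<omega> by (intro bexI[of _ ?n]) (auto simp: deviation_event_def abs_if split: if_splits)
qed

lemma concentration:
  fixes \<delta> :: real and W :: "nat \<Rightarrow> nat"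
  assumes \<delta>: "0 < \<delta>" "\<delta> < 1"
    and nondeg: "m * CARD('s) * CARD('a) * H * T \<noteq> 1 \<or> \<delta> \<le> exp (- 1 / 4)"
  shows "prob {\<omega> \<in> space M. \<forall>i\<in>{1..m}. \<forall>h\<in>{1..H}. \<forall>t\<in>{1..T}. \<forall>s a.
           \<bar>alpha_hat W st ac sig i h t s a \<omega> - \<alpha> i h\<bar> \<le> zeta m H T \<delta> W st ac h t s a \<omega>}
         \<ge> 1 - \<delta>" (is "prob ?G \<ge> _")
\<comment> \<open>Here the logarithm has argument 0, but the quantifiers range over an empty
  set.\<close>
proof (cases "m = 0 \<or> H = 0 \<or> T = 0")
  case True
  then have "?G = space M" by auto
  then show ?thesis using \<delta> by (simp add: prob_space)
next
  case False
  define K where "K = m * CARD('s) * CARD('a) * H * T"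
  define x where "x = 4 * ln (real K / \<delta>)"
  have K: "1 \<le> K" "T \<le> K" using False by (auto simp: K_def Suc_le_eq)
  note bounds = ln_card_bounds[OF \<delta> K(1)]
  have x: "1 \<le> x" using bounds(1) nondeg by (simp add: x_def K_def)
  define I where "I = {1..m} \<times> {1..H} \<times> {1..T} \<times> (UNIV :: 's set) \<times> (UNIV :: 'a set) \<times> {1..T} \<times> {-1, 1::real}"
  define E where "E = (\<lambda>(i, h, t, s, a, n, c). deviation_event W x i h t s a n c)"
  have E: "E j \<in> sets M" "prob (E j) \<le> exp (- 2 * x)" if "j \<in> I" for j
    using that x prob_deviation_event[where x = x and W = W] unfolding E_def I_def
    by (force split: prod.splits intro!: deviation_event_sets)+
  have fin: "finite I" unfolding I_def by simp
  have sets: "?G \<in> sets M"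
  proof -
    have [measurable]: "Measurable.pred M (\<lambda>\<omega>. \<bar>alpha_hat W st ac sig i h t s a \<omega> - \<alpha> i h\<bar> \<le> zeta m H T \<delta> W st ac h t s a \<omega>)"
      if i: "i \<in> {1..m}" and h: "h \<in> {1..H}" and t: "t \<in> {1..T}" for i h t s a
    proof -
      have l: "l \<in> {1..T}" if "l \<in> {window_start W t..u}" "u \<le> t" for l u
        using that t by (auto simp: window_start_def)
      have [measurable]: "(\<lambda>\<omega>. visit_count W st ac h t u s a \<omega>) \<in> measurable M (count_space UNIV)"
        if "u \<le> t" for u
        unfolding visit_count_def using visit_measurable[OF l[OF _ that] h] by measurable
      have [measurable]: "(\<lambda>\<omega>. visit_count W st ac h t t s a \<omega>) \<in> measurable M (count_space UNIV)"
         "(\<lambda>\<omega>. visit_count W st ac h t (t - 1) s a \<omega>) \<in> measurable M (count_space UNIV)"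
        by simp_all
      have [measurable]: "(\<lambda>\<omega>. \<Sum>l = window_start W t..t. sig i h l s a \<omega> * of_bool (visit h l s a \<omega>)) \<in> borel_measurable M"
        using visit_measurable[OF l[OF _ order_refl] h] signal_measurable[OF i h l[OF _ order_refl]] by measurable
      show ?thesis unfolding alpha_hat_def zeta_def by measurable
    qed
    show ?thesis by measurable
  qed
  have "AE \<omega> in M. \<forall>i\<in>{1..m}. \<forall>h\<in>{1..H}. \<forall>l\<in>{1..T}. \<forall>s a. visit h l s a \<omega> \<longrightarrow> sig i h l s a \<omega> \<in> {0..1}"
    by (intro AE_finite_allI AE_signal_unit_interval finite_atLeastAtMost AE_all_countable[THEN iffD2] allI)
       assumption+
  \<comment> \<open>The inclusion is claimed only almost everywhere, since observed signals may
    leave [0,1] on a null set.\<close>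
  then have "AE \<omega> in M. \<omega> \<in> space M - ?G \<longrightarrow> \<omega> \<in> (\<Union>j\<in>I. E j)"
  proof eventually_elim
    case (elim \<omega>)
    show ?case
    proof
      assume "\<omega> \<in> space M - ?G"
      then obtain i h t s a where iht: "i \<in> {1..m}" "h \<in> {1..H}" "t \<in> {1..T}" "\<omega> \<in> space M"
        "\<bar>alpha_hat W st ac sig i h t s a \<omega> - \<alpha> i h\<bar> > zeta m H T \<delta> W st ac h t s a \<omega>"
        by (auto simp: not_le)
      then have "\<exists>n\<in>{1..T}. \<exists>c\<in>{- 1, 1}. \<omega> \<in> deviation_event W x i h t s a n c"
        unfolding x_def K_def
        by (intro zeta_exceeded_imp_deviation_event) (use elim x in \<open>auto simp: x_def K_def\<close>)
      then obtain n c where "n \<in> {1..T}" "c \<in> {-1, 1}" "\<omega> \<in> deviation_event W x i h t s a n c"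
        by blast
      with iht have "(i, h, t, s, a, n, c) \<in> I" "\<omega> \<in> E (i, h, t, s, a, n, c)"
        by (auto simp: I_def E_def)
      then show "\<omega> \<in> (\<Union>j\<in>I. E j)" by blast
    qed
  qed
  then have "prob (space M - ?G) \<le> prob (\<Union>j\<in>I. E j)"
    by (rule finite_measure_mono_AE) (use E fin in auto)
  also have "\<dots> \<le> (\<Sum>j\<in>I. prob (E j))"
    by (rule finite_measure_subadditive_finite) (use E fin in auto)
  also have "\<dots> \<le> card I * exp (- 2 * x)"
    using E by (intro sum_bounded_above)
  \<comment> \<open>\<open>I\<close> has \<open>K\<close> choices of constraint, step, episode and
    pair, \<open>T\<close> of the count and 2 of the sign; \<open>2 * x\<close> is
    \<open>8 * ln (K / \<delta>)\<close>.\<close>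
  also have "\<dots> = 2 * real K * real T * exp (- 8 * ln (real K / \<delta>))"
    by (simp add: I_def K_def x_def card_cartesian_product)
  also have "\<dots> \<le> \<delta>"
    using bounds(2) nondeg K by (simp add: K_def)
  finally show ?thesis using prob_compl[OF sets] by simp
qed

end

text \<open>The condition \<open>nondegenerate\<close> concerns only the case where all index sets
  are singletons; there it says \<open>4 * ln (1 / \<delta>) \<ge> 1\<close>. Without it the bound
  can fail: for a fair coin signal in {0,1} the error is 1/2 almost surely, while the radius tends
  to 0 as \<delta> tends to 1.\<close>

theorem theorem1:
  fixes M :: "'w measure"
    and m H T :: nat
    and s1 :: "'s :: finite"
    and p :: "nat \<Rightarrow> 's \<Rightarrow> 'a :: finite \<Rightarrow> 's pmf"
    and \<L> :: "nat \<Rightarrow> nat \<Rightarrow> real measure"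
    and \<alpha> :: "nat \<Rightarrow> nat \<Rightarrow> real"
    and \<pi> :: "nat \<Rightarrow> nat \<Rightarrow> 'w \<Rightarrow> 's \<Rightarrow> 'a pmf"
    and st :: "nat \<Rightarrow> nat \<Rightarrow> 'w \<Rightarrow> 's"
    and ac :: "nat \<Rightarrow> nat \<Rightarrow> 'w \<Rightarrow> 'a"
    and sig :: "nat \<Rightarrow> nat \<Rightarrow> nat \<Rightarrow> 's \<Rightarrow> 'a \<Rightarrow> 'w \<Rightarrow> real"
    and FS FA FO :: "nat \<Rightarrow> nat \<Rightarrow> 'w measure"
    and W :: "nat \<Rightarrow> nat"
    and \<delta> :: real
  assumes "cmdp_stochastic_thresholds M m H T s1 p \<L> \<alpha> \<pi> st ac sig FS FA FO"
    and "mono_on {1..T} W"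
    and "0 < \<delta>" and "\<delta> < 1"
    and nondegenerate: "m * CARD('s) * CARD('a) * H * T \<noteq> 1 \<or> \<delta> \<le> exp (- 1 / 4)"
  shows "measure M {\<omega> \<in> space M. \<forall>i\<in>{1..m}. \<forall>h\<in>{1..H}. \<forall>t\<in>{1..T}. \<forall>s a.
           \<bar>alpha_hat W st ac sig i h t s a \<omega> - \<alpha> i h\<bar> \<le> zeta m H T \<delta> W st ac h t s a \<omega>}
         \<ge> 1 - \<delta>"
proof -
  interpret cmdp_stochastic_thresholds M m H T s1 p \<L> \<alpha> \<pi> st ac sig FS FA FO by fact
  show ?thesis using assms(3,4) nondegenerate by (rule concentration)
qed

end
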